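(* Let $F$ be a field, $m\ge1$, $I=\{1,\dots,m\}$, let $a\in\mathcal O_m$ be an associative binary operation on $I$, and let $\mathfrak C_a$ be the corresponding algebra of cubic matrices over $F$ with basis $\{E_{ijk}: i,j,k\in I\}$. Let $J_a=\{a(i,j): i,j\in I\}$ be the image of $a$. 1. If $\tilde J\subset J_a$ is $a$-invariant, then for each fixed $i,k\in I$ the linear span of $\mathcal E^{ik}_{\tilde J}=\{E_{ijk}: j\in\tilde J\}$ is a subalgebra of $\mathfrak C_a$, denoted by $\mathfrak C^{(ik)}_{a,\tilde J}$. 2. If $\tilde J\subset J_a$ is $a$-invariant and $i,k,\tilde i,\tilde k\in I$ satisfy $i\ne\tilde i$ or $k\ne\tilde k$, then $\mathfrak C^{(ik)}_{a,\tilde J}\cap\mathfrak C^{(\tilde i\tilde k)}_{a,\tilde J}=\{0\}$. 3. If $\tilde J,\bar J\subset J_a$ are $a$-invariant sets such that $\tilde J\subset\bar J$, then $\mathfrak C^{(ik)}_{a,\tilde J}\subset\mathfrak C^{(ik)}_{a,\bar J}$ for all $i,k\in I$. 4. If $\tilde J,\bar J\subset J_a$ are $a$-invariant sets such that $\tilde J\cap\bar J=\emptyset$, then $\mathfrak C^{(ik)}_{a,\tilde J}\cap\mathfrak C^{(ik)}_{a,\bar J}=\{0\}$ for all $i,k\in I$. 5. The linear span $\mathfrak I_a$ of $\{E_{ijk}: i,k\in I,\ j\in J_a\}$ is a (two-sided) ideal of $\mathfrak C_a$. 6. The set $\mathfrak I_a^0=\{X=(x_{inj})\in\mathfrak C_a:\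 \sum_{n=1}^m x_{inj}=0\ \text{for all } i,j\in I\}$ is a (two-sided) ideal of $\mathfrak C_a$.
   Context: $\mathcal O_m$ denotes the set of all associative binary operations $a\colon I\times I\to I$. $\mathfrak C$ is the $m^3$-dimensional $F$-vector space of cubic matrices $A=(a_{ijk})_{i,j,k=1}^m$ with entries in $F$ (entrywise addition and scalar multiplication), with standard basis $E_{ijk}$ (the $(i,j,k)$ entry of $E_{ijk}$ is $1$ and all others are $0$). For $a\in\mathcal O_m$, the multiplication $*_a$ on $\mathfrak C$ is the bilinear extension of $$E_{ijk}*_aE_{lnr}=\delta_{kl}\,E_{i\,a(j,n)\,r},$$ where $\delta_{kl}$ is the Kronecker symbol, and $\mathfrak C_a=(\mathfrak C,*_a)$. A subset $\tilde J\subset I$ is $a$-invariant if $a(s,t)\in\tilde J$ for all $s,t\in\tilde J$. A subalgebra is a subset closed under addition, scalar multiplication and multiplication (no unit is required). An ideal is a linear subspace such that multiplying any of its elements on the left or on the right by any element of the algebra gives an element of the subspace. *)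

theory Defs
  imports "HOL-Analysis.Cartesian_Space"
begin

text \<open>The index set \<open>I = {1,\<dots>,m}\<close> is a finite type \<open>'n\<close> with \<open>m = CARD('n)\<close> (so \<open>m \<ge> 1\<close>), and a cubic
  matrix is a vector indexed by triples. This makes the library's vector space structure
  \<open>(+)\<close>, \<open>(*s)\<close>, \<open>vec.span\<close>, \<open>vec.subspace\<close> over the field \<open>'f\<close> available.\<close>

type_synonym ('f, 'n) cubic = "'f ^ ('n \<times> 'n \<times> 'n)"

definition cubic_unit :: "'n::finite \<Rightarrow> 'n \<Rightarrow> 'n \<Rightarrow> ('f::field, 'n) cubic" where
  "cubic_unit i j k = axis (i, j, k) 1"

text \<open>The bilinear extension of \<open>E(i,j,k) * E(l,n,r) = \<delta>(k,l) E(i,a(j,n),r)\<close>; see \<open>cubic_mult_unit\<close> and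
  \<open>cubic_mult_linear_left\<close>, \<open>cubic_mult_linear_right\<close> below.\<close>

definition cubic_mult ::
  "('n::finite \<Rightarrow> 'n \<Rightarrow> 'n) \<Rightarrow> ('f::field, 'n) cubic \<Rightarrow> ('f, 'n) cubic \<Rightarrow> ('f, 'n) cubic" where
  "cubic_mult a A B =
     (\<Sum>(i, j, k)\<in>UNIV. \<Sum>(l, n, r)\<in>UNIV.
        (A $ (i, j, k) * B $ (l, n, r)) *s (if k = l then cubic_unit i (a j n) r else 0))"

definition op_image :: "('n \<Rightarrow> 'n \<Rightarrow> 'n) \<Rightarrow> 'n set" where
  "op_image a = {a i j | i j. True}"

definition op_invariant :: "('n \<Rightarrow> 'n \<Rightarrow> 'n) \<Rightarrow> 'n set \<Rightarrow> bool" where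
  "op_invariant a J \<longleftrightarrow> (\<forall>s\<in>J. \<forall>t\<in>J. a s t \<in> J)"

definition is_subalgebra ::
  "('n::finite \<Rightarrow> 'n \<Rightarrow> 'n) \<Rightarrow> ('f::field, 'n) cubic set \<Rightarrow> bool" where
  "is_subalgebra a S \<longleftrightarrow> vec.subspace S \<and> (\<forall>X\<in>S. \<forall>Y\<in>S. cubic_mult a X Y \<in> S)"

definition is_ideal ::
  "('n::finite \<Rightarrow> 'n \<Rightarrow> 'n) \<Rightarrow> ('f::field, 'n) cubic set \<Rightarrow> bool" where
  "is_ideal a S \<longleftrightarrow>
     vec.subspace S \<and> (\<forall>X\<in>S. \<forall>Y. cubic_mult a X Y \<in> S \<and> cubic_mult a Y X \<in> S)"

text \<open>The underlying set of the algebra attached to \<open>a\<close>, \<open>J\<close> and \<open>(i, k)\<close>; only its product, not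
  this set, depends on \<open>a\<close>.\<close>

definition cubic_line :: "'n::finite \<Rightarrow> 'n \<Rightarrow> 'n set \<Rightarrow> ('f::field, 'n) cubic set" where
  "cubic_line i k J = vec.span {cubic_unit i j k | j. j \<in> J}"

definition image_ideal :: "('n::finite \<Rightarrow> 'n \<Rightarrow> 'n) \<Rightarrow> ('f::field, 'n) cubic set" where
  "image_ideal a = vec.span {cubic_unit i j k | i j k. j \<in> op_image a}"

definition zero_sum_ideal :: "('f::field, 'n::finite) cubic set" where
  "zero_sum_ideal = {X. \<forall>i j. (\<Sum>n\<in>UNIV. X $ (i, n, j)) = 0}"

lemma cubic_mult_unit:
  "cubic_mult a (cubic_unit i j k) (cubic_unit l n r :: ('f::field, 'n::finite) cubic) =
     (if k = l then cubic_unit i (a j n) r else 0)"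
proof -
  define g where "g = (\<lambda>(p :: 'n \<times> 'n \<times> 'n) (q :: 'n \<times> 'n \<times> 'n).
    (if snd (snd p) = fst q then cubic_unit (fst p) (a (fst (snd p)) (fst (snd q))) (snd (snd q))
     else (0 :: ('f, 'n) cubic)))"
  have "cubic_mult a (cubic_unit i j k) (cubic_unit l n r :: ('f, 'n) cubic) =
    (\<Sum>p\<in>UNIV. \<Sum>q\<in>UNIV. (if q = (l, n, r) then if p = (i, j, k) then g p q else 0 else 0))"
    unfolding cubic_mult_def case_prod_beta
    by (intro sum.cong refl) (auto simp: g_def cubic_unit_def axis_def)
  also have "\<dots> = g (i, j, k) (l, n, r)"
    by (simp add: sum.delta)
  finally show ?thesis by (simp add: g_def)
qed

lemma cubic_mult_linear_left: "Vector_Spaces.linear (*s) (*s) (\<lambda>A. cubic_mult a A B)"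
  by unfold_locales
    (simp_all add: cubic_mult_def case_prod_beta algebra_simps vec.scale_left_distrib
       sum.distrib vec.scale_sum_right)

lemma cubic_mult_linear_right: "Vector_Spaces.linear (*s) (*s) (cubic_mult a A)"
  by unfold_locales
    (simp_all add: cubic_mult_def case_prod_beta algebra_simps vec.scale_left_distrib
       sum.distrib vec.scale_sum_right)

end

theory Submission
  imports Defs
begin

text \<open>
  Two descriptions of the subspaces involved make all six claims short.

  First, a span of matrix units is the set of cubic matrices supported on the corresponding index
  triples (\<open>span_cubic_units\<close>). The lines and the image ideal are therefore given by support
  conditions, so inclusions and trivial intersections reduce to set theory on triples, and closure
  under products follows from the entrywise product formula \<open>cubic_mult_nth\<close>: a nonzero entry
  \<open>(i, p, r)\<close> of a product comes from nonzero entries \<open>(i, j, k)\<close> and \<open>(k, n, r)\<close> of the factors with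
  \<open>p = a j n\<close> (\<open>cubic_mult_nonzeroE\<close>). In particular \<open>p\<close> always lies in the image of \<open>a\<close>.

  Second, summing over the middle index is a linear multiplicative map onto ordinary square
  matrices (\<open>middle_sum_mult\<close>), because each pair \<open>(j, n)\<close> contributes to exactly one middle index
  \<open>p = a j n\<close>. The matrices with vanishing middle sums are its kernel.
\<close>

lemma cubic_unit_nth:
  "cubic_unit i j k $ (x, y, z) = (if x = i \<and> y = j \<and> z = k then 1 else 0)"
  by (auto simp: cubic_unit_def axis_def)

lemma span_cubic_units:
  "vec.span {cubic_unit i j k | i j k. (i, j, k) \<in> S} =
     {X :: ('f::field, 'n::finite) cubic. \<forall>p. p \<notin> S \<longrightarrow> X $ p = 0}" (is "vec.span ?B = ?R")
proof
  have "vec.subspace ?R"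
    by (simp add: vec.subspace_def)
  moreover have "?B \<subseteq> ?R"
    by (auto simp: cubic_unit_def axis_def)
  ultimately show "vec.span ?B \<subseteq> ?R"
    by (intro vec.span_minimal)
  show "?R \<subseteq> vec.span ?B"
  proof
    fix X :: "('f, 'n) cubic" assume X: "X \<in> ?R"
    have "X $ p *s axis p 1 \<in> vec.span ?B" for p
    proof (cases "p \<in> S")
      case True
      then have "axis p 1 \<in> ?B"
        by (cases p) (auto simp: cubic_unit_def)
      then show ?thesis
        by (intro vec.span_scale vec.span_base)
    next
      case False
      then have "X $ p = 0" using X by blast
      then show ?thesis by (simp only: vec.scale_zero_left vec.span_zero)
    qed
    then have "(\<Sum>p\<in>UNIV. X $ p *s axis p 1) \<in> vec.span ?B"
      by (intro vec.span_sum)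
    then show "X \<in> vec.span ?B"
      by (simp add: basis_expansion)
  qed
qed

lemma cubic_line_eq:
  "cubic_line i k J =
     {X :: ('f::field, 'n::finite) cubic. \<forall>x y z. X $ (x, y, z) \<noteq> 0 \<longrightarrow> x = i \<and> y \<in> J \<and> z = k}"
proof -
  have "{cubic_unit i j k :: ('f, 'n) cubic | j. j \<in> J} =
      {cubic_unit x y z | x y z. (x, y, z) \<in> {i} \<times> J \<times> {k}}"
    by blast
  then show ?thesis
    unfolding cubic_line_def by (simp only: span_cubic_units) auto
qed

lemma image_ideal_eq:
  "image_ideal a =
     {X :: ('f::field, 'n::finite) cubic. \<forall>x y z. X $ (x, y, z) \<noteq> 0 \<longrightarrow> y \<in> op_image a}"
proof -
  have "{cubic_unit i j k :: ('f, 'n) cubic | i j k. j \<in> op_image a} =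
      {cubic_unit x y z | x y z. (x, y, z) \<in> UNIV \<times> op_image a \<times> UNIV}"
    by blast
  then show ?thesis
    unfolding image_ideal_def by (simp only: span_cubic_units) auto
qed

lemma sum_UNIV_triple:
  fixes g :: "'a::finite \<times> 'b::finite \<times> 'c::finite \<Rightarrow> 'd::comm_monoid_add"
  shows "(\<Sum>p\<in>UNIV. g p) = (\<Sum>i\<in>UNIV. \<Sum>j\<in>UNIV. \<Sum>k\<in>UNIV. g (i, j, k))"
proof -
  have "(\<Sum>p\<in>UNIV. g p) = (\<Sum>i\<in>UNIV. \<Sum>q\<in>UNIV. g (i, q))"
    by (simp add: sum.cartesian_product)
  also have "\<dots> = (\<Sum>i\<in>UNIV. \<Sum>j\<in>UNIV. \<Sum>k\<in>UNIV. g (i, j, k))"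
    by (simp add: sum.cartesian_product)
  finally show ?thesis .
qed

text \<open>The middle index behaves as in a semigroup algebra (a convolution along \<open>a\<close>), the outer
  indices as in matrix multiplication.\<close>

lemma cubic_mult_nth:
  fixes X Y :: "('f::field, 'n::finite) cubic"
  shows "cubic_mult a X Y $ (i, p, r) =
    (\<Sum>j\<in>UNIV. \<Sum>k\<in>UNIV. \<Sum>n\<in>UNIV. if a j n = p then X $ (i, j, k) * Y $ (k, n, r) else 0)"
proof -
  have pull_if: "(if c then \<Sum>u\<in>UNIV. g u else 0) = (\<Sum>u\<in>UNIV. if c then g u else 0)"
    for c and g :: "'n \<Rightarrow> 'f"
    by simp
  have "cubic_mult a X Y $ (i, p, r) =
    (\<Sum>x\<in>UNIV. \<Sum>j\<in>UNIV. \<Sum>k\<in>UNIV. \<Sum>l\<in>UNIV. \<Sum>n\<in>UNIV. \<Sum>z\<in>UNIV.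
      if x = i then if l = k then if z = r then
        if a j n = p then X $ (i, j, k) * Y $ (k, n, r) else 0 else 0 else 0 else 0)"
    unfolding cubic_mult_def sum_UNIV_triple
    by (simp add: if_distrib[of "\<lambda>v. _ *s v"] if_distrib[of "\<lambda>v. v $ _"] cubic_unit_nth
      cong: if_cong, intro sum.cong refl) auto
  \<comment> \<open>Each index test moves to directly below the sum over its index, where that sum collapses.\<close>
  also have "\<dots> = (\<Sum>x\<in>UNIV. if x = i then \<Sum>j\<in>UNIV. \<Sum>k\<in>UNIV. \<Sum>l\<in>UNIV. if l = k then
      \<Sum>n\<in>UNIV. \<Sum>z\<in>UNIV. if z = r then
        if a j n = p then X $ (i, j, k) * Y $ (k, n, r) else 0 else 0 else 0 else 0)"
    by (simp only: pull_if)
  finally show ?thesis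
    by simp
qed

lemma cubic_mult_nonzeroE:
  fixes X Y :: "('f::field, 'n::finite) cubic"
  assumes "cubic_mult a X Y $ (i, p, r) \<noteq> 0"
  obtains j k n where "p = a j n" "X $ (i, j, k) \<noteq> 0" "Y $ (k, n, r) \<noteq> 0"
proof -
  obtain j k n where "(if a j n = p then X $ (i, j, k) * Y $ (k, n, r) else 0) \<noteq> 0"
    using assms unfolding cubic_mult_nth by (elim sum.not_neutral_contains_not_neutral)
  then show thesis
    using that[of j n k] by (auto split: if_splits)
qed

lemma middle_sum_mult:
  fixes X Y :: "('f::field, 'n::finite) cubic"
  shows "(\<Sum>p\<in>UNIV. cubic_mult a X Y $ (i, p, r)) =
    (\<Sum>k\<in>UNIV. (\<Sum>j\<in>UNIV. X $ (i, j, k)) * (\<Sum>n\<in>UNIV. Y $ (k, n, r)))"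
proof -
  have "(\<Sum>p\<in>UNIV. cubic_mult a X Y $ (i, p, r)) =
      (\<Sum>j\<in>UNIV. \<Sum>p\<in>UNIV. \<Sum>k\<in>UNIV. \<Sum>n\<in>UNIV.
        if a j n = p then X $ (i, j, k) * Y $ (k, n, r) else 0)"
    unfolding cubic_mult_nth by (rule sum.swap)
  also have "\<dots> = (\<Sum>j\<in>UNIV. \<Sum>k\<in>UNIV. \<Sum>p\<in>UNIV. \<Sum>n\<in>UNIV.
      if a j n = p then X $ (i, j, k) * Y $ (k, n, r) else 0)"
    by (intro sum.cong refl sum.swap)
  also have "\<dots> = (\<Sum>j\<in>UNIV. \<Sum>k\<in>UNIV. \<Sum>n\<in>UNIV. \<Sum>p\<in>UNIV.
      if a j n = p then X $ (i, j, k) * Y $ (k, n, r) else 0)"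
    by (intro sum.cong refl sum.swap)
  \<comment> \<open>The innermost sum has the single nonzero term \<open>p = a j n\<close>; this is where \<open>a\<close> disappears.\<close>
  also have "\<dots> = (\<Sum>j\<in>UNIV. \<Sum>k\<in>UNIV. \<Sum>n\<in>UNIV. X $ (i, j, k) * Y $ (k, n, r))"
    by simp
  also have "\<dots> = (\<Sum>k\<in>UNIV. \<Sum>j\<in>UNIV. \<Sum>n\<in>UNIV. X $ (i, j, k) * Y $ (k, n, r))"
    by (rule sum.swap)
  finally show ?thesis
    by (simp add: sum_product)
qed

lemma subalgebra_cubic_line:
  assumes "op_invariant a J"
  shows "is_subalgebra a (cubic_line i k J :: ('f::field, 'n::finite) cubic set)"
proof -
  have "vec.subspace (cubic_line i k J :: ('f, 'n) cubic set)"
    by (simp add: cubic_line_def)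
  moreover have "cubic_mult a X Y \<in> cubic_line i k J"
    if "X \<in> cubic_line i k J" "Y \<in> cubic_line i k J" for X Y :: "('f, 'n) cubic"
    using that assms unfolding cubic_line_eq op_invariant_def
    by (auto elim!: cubic_mult_nonzeroE)
  ultimately show ?thesis
    by (simp add: is_subalgebra_def)
qed

lemma cubic_line_mono: "J \<subseteq> J' \<Longrightarrow> cubic_line i k J \<subseteq> cubic_line i k J'"
  unfolding cubic_line_def by (intro vec.span_mono) blast

lemma cubic_line_Int_trivial:
  assumes "i \<noteq> i' \<or> k \<noteq> k' \<or> J \<inter> J' = {}"
  shows "cubic_line i k J \<inter> cubic_line i' k' J' = ({0} :: ('f::field, 'n::finite) cubic set)"
proof -
  have "X = 0"
    if X: "X \<in> cubic_line i k J" "X \<in> cubic_line i' k' J'" for X :: "('f, 'n) cubic"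
  proof -
    have "X $ (x, y, z) = 0" for x y z
      using X assms unfolding cubic_line_eq by blast
    then show ?thesis
      by (simp add: vec_eq_iff)
  qed
  moreover have "(0 :: ('f, 'n) cubic) \<in> cubic_line i k J" for i k J
    by (simp add: cubic_line_def vec.span_zero)
  ultimately show ?thesis
    by blast
qed

lemma ideal_image_ideal: "is_ideal a (image_ideal a :: ('f::field, 'n::finite) cubic set)"
proof -
  have "vec.subspace (image_ideal a :: ('f, 'n) cubic set)"
    by (simp add: image_ideal_def)
  moreover have "cubic_mult a X Y \<in> image_ideal a" for X Y :: "('f, 'n) cubic"
    unfolding image_ideal_eq op_image_def by (auto elim!: cubic_mult_nonzeroE)
  ultimately show ?thesis
    by (simp add: is_ideal_def)
qed

lemma ideal_zero_sum_ideal: "is_ideal a (zero_sum_ideal :: ('f::field, 'n::finite) cubic set)"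
proof -
  have "vec.subspace (zero_sum_ideal :: ('f, 'n) cubic set)"
    by (simp add: vec.subspace_def zero_sum_ideal_def sum.distrib flip: sum_distrib_left)
  then show ?thesis
    by (simp add: is_ideal_def zero_sum_ideal_def middle_sum_mult)
qed

theorem theorem7p1:
  fixes a :: "'n::finite \<Rightarrow> 'n \<Rightarrow> 'n"
  assumes "semigroup a"
  shows
    "(\<forall>J. J \<subseteq> op_image a \<and> op_invariant a J \<longrightarrow>
        (\<forall>i k. is_subalgebra a (cubic_line i k J :: ('f::field, 'n) cubic set)))
   \<and> (\<forall>J i k i' k'. J \<subseteq> op_image a \<and> op_invariant a J \<and> (i \<noteq> i' \<or> k \<noteq> k') \<longrightarrow>
        cubic_line i k J \<inter> cubic_line i' k' J = ({0} :: ('f, 'n) cubic set))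
   \<and> (\<forall>J J'. J \<subseteq> op_image a \<and> op_invariant a J \<and> J' \<subseteq> op_image a \<and> op_invariant a J'
          \<and> J \<subseteq> J' \<longrightarrow>
        (\<forall>i k. (cubic_line i k J :: ('f, 'n) cubic set) \<subseteq> cubic_line i k J'))
   \<and> (\<forall>J J'. J \<subseteq> op_image a \<and> op_invariant a J \<and> J' \<subseteq> op_image a \<and> op_invariant a J'
          \<and> J \<inter> J' = {} \<longrightarrow>
        (\<forall>i k. cubic_line i k J \<inter> cubic_line i k J' = ({0} :: ('f, 'n) cubic set)))
   \<and> is_ideal a (image_ideal a :: ('f, 'n) cubic set)
   \<and> is_ideal a (zero_sum_ideal :: ('f, 'n) cubic set)"
  by (intro conjI allI impI subalgebra_cubic_line cubic_line_Int_trivial cubic_line_mono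
      ideal_image_ideal ideal_zero_sum_ideal) auto

end
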